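(* Let $b=(n_1,\ldots,n_m)$ be a block structure with $\sum_i n_i=N$, and let $A\in\mathbb{R}^{N\times N}$ be a symmetric positive semidefinite matrix with $A^{(i,i)}=I_{n_i}$ for all $i=1,\ldots,m$. Let $x^*$ be an optimal solution of $$\max_{x\in\mathbb{R}^N}\ \mathrm{trace}(Axx^T)\quad\text{subject to}\quad \mathrm{trace}(B_ixx^T)=1,\ i=1,\ldots,m,$$ and let $X^*$ be an optimal solution of the semidefinite program $$\max_{X}\ \mathrm{trace}(AX)\quad\text{subject to}\quad \mathrm{trace}(B_iX)=1,\ i=1,\ldots,m,$$ where $X$ ranges over symmetric positive semidefinite $N\times N$ matrices. Put $\phi^*:=\mathrm{trace}(Ax^*x^{*T})$ and $\psi^*:=\mathrm{trace}(AX^* )$. Then $$\frac{2}{\pi}\,\psi^*\le\phi^*\le\psi^*.$$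
   Context: Block notation: for $b=(n_1,\ldots,n_m)$ with $\sum_i n_i=N$, a vector $x\in\mathbb{R}^N$ is split into consecutive sub-vectors $x^{(i)}\in\mathbb{R}^{n_i}$, and a matrix $M\in\mathbb{R}^{N\times N}$ into blocks $M^{(i,j)}\in\mathbb{R}^{n_i\times n_j}$. The matrix $B_i\in\mathbb{R}^{N\times N}$ is the one whose $(i,i)$ block is the identity $I_{n_i}$ and all of whose other blocks are zero; thus $\mathrm{trace}(B_ixx^T)=x^{(i)T}x^{(i)}$. *)

theory Defs
  imports Complex_Main "Jordan_Normal_Form.Matrix"
begin

text \<open>
  A block structure is a list \<open>b\<close> of block sizes, so \<open>N = sum_list b\<close>, and blocks, like all
  vector and matrix indices, are numbered from 0: block \<open>i\<close> occupies the indices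
  \<open>block_start b i, \<dots>, block_start b i + b ! i - 1\<close>.
\<close>

definition block_start :: "nat list \<Rightarrow> nat \<Rightarrow> nat" where
  "block_start b i = sum_list (take i b)"

definition vec_block :: "nat list \<Rightarrow> 'a vec \<Rightarrow> nat \<Rightarrow> 'a vec" where
  "vec_block b x i = vec (b ! i) (\<lambda>r. x $ (block_start b i + r))"

definition mat_block :: "nat list \<Rightarrow> 'a mat \<Rightarrow> nat \<Rightarrow> nat \<Rightarrow> 'a mat" where
  "mat_block b M i j =
     mat (b ! i) (b ! j) (\<lambda>(r, c). M $$ (block_start b i + r, block_start b j + c))"

text \<open>\<open>block_proj b i\<close> is the matrix usually written B sub i, with identity block (i, i) and zero blocks elsewhere.\<close>

definition block_proj :: "nat list \<Rightarrow> nat \<Rightarrow> real mat" where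
  "block_proj b i = diag_block_mat
     (map (\<lambda>k. if k = i then 1\<^sub>m (b ! k) else 0\<^sub>m (b ! k) (b ! k)) [0..<length b])"

text \<open>Used for square matrices only.\<close>

definition mat_trace :: "'a::comm_monoid_add mat \<Rightarrow> 'a" where
  "mat_trace A = (\<Sum>i<dim_row A. A $$ (i, i))"

text \<open>\<open>x x\<^sup>T\<close>, as the product of a one-column and a one-row matrix.\<close>

definition outer :: "'a::semiring_0 vec \<Rightarrow> 'a mat" where
  "outer x = mat_of_cols (dim_vec x) [x] * mat_of_rows (dim_vec x) [x]"

definition psd_mat :: "nat \<Rightarrow> real mat \<Rightarrow> bool" where
  "psd_mat n A \<longleftrightarrow> A \<in> carrier_mat n n \<and> transpose_mat A = A \<and>
     (\<forall>v \<in> carrier_vec n. 0 \<le> v \<bullet> (A *\<^sub>v v))"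

definition qp_feasible :: "nat list \<Rightarrow> real vec \<Rightarrow> bool" where
  "qp_feasible b x \<longleftrightarrow> x \<in> carrier_vec (sum_list b) \<and>
     (\<forall>i<length b. mat_trace (block_proj b i * outer x) = 1)"

definition sdp_feasible :: "nat list \<Rightarrow> real mat \<Rightarrow> bool" where
  "sdp_feasible b X \<longleftrightarrow> psd_mat (sum_list b) X \<and>
     (\<forall>i<length b. mat_trace (block_proj b i * X) = 1)"

lemma outer_carrier [simp]: "outer x \<in> carrier_mat (dim_vec x) (dim_vec x)"
  unfolding outer_def by (rule carrier_matI) simp_all

lemma outer_index [simp]:
  "r < dim_vec x \<Longrightarrow> c < dim_vec x \<Longrightarrow> outer x $$ (r, c) = x $ r * x $ c"
  by (simp add: outer_def scalar_prod_def mat_of_cols_def mat_of_rows_def)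

lemma diag_block_indicator_index:
  fixes P :: "nat \<Rightarrow> bool" and b :: "nat list"
  defines "D \<equiv> \<lambda>(P :: nat \<Rightarrow> bool) b. diag_block_mat
     (map (\<lambda>k. if P k then 1\<^sub>m (b ! k) else 0\<^sub>m (b ! k) (b ! k)) [0..<length b]) :: real mat"
  shows "D P b \<in> carrier_mat (sum_list b) (sum_list b) \<and>
    (\<forall>r<sum_list b. \<forall>c<sum_list b. D P b $$ (r, c) =
      (if r = c \<and> (\<exists>k<length b. P k \<and> block_start b k \<le> r \<and> r < block_start b k + b ! k)
       then 1 else 0))"
proof (induction b arbitrary: P)
  case Nil
  then show ?case by (simp add: D_def)
next
  case (Cons n b)
  define Q where "Q = (\<lambda>k. P (Suc k))"
  let ?A = "if P 0 then 1\<^sub>m n else 0\<^sub>m n n :: real mat"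
  have A: "?A \<in> carrier_mat n n" by simp
  have D: "D P (n # b) = four_block_mat ?A (0\<^sub>m n (sum_list b)) (0\<^sub>m (sum_list b) n) (D Q b)"
  proof -
    let ?f = "\<lambda>k. if P k then 1\<^sub>m ((n # b) ! k) else 0\<^sub>m ((n # b) ! k) ((n # b) ! k) :: real mat"
    have "D P (n # b) = diag_block_mat (?A # map (\<lambda>k. ?f (Suc k)) [0..<length b])"
      by (simp add: D_def map_upt_Suc del: upt_Suc)
    also have "map (\<lambda>k. ?f (Suc k)) [0..<length b] =
        map (\<lambda>k. if Q k then 1\<^sub>m (b ! k) else 0\<^sub>m (b ! k) (b ! k)) [0..<length b]"
      by (simp add: Q_def)
    also have "diag_block_mat (?A # \<dots>) = four_block_mat ?A
        (0\<^sub>m (dim_row ?A) (dim_col (D Q b))) (0\<^sub>m (dim_row (D Q b)) (dim_col ?A)) (D Q b)"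
      by (simp only: D_def diag_block_mat.simps Let_def)
    also have "dim_row (D Q b) = sum_list b"
      using Cons.IH[of Q] by auto
    also have "dim_col (D Q b) = sum_list b"
      using Cons.IH[of Q] by auto
    also have "dim_row ?A = n" by simp
    also have "dim_col ?A = n" by simp
    finally show ?thesis .
  qed
  have ex: "(\<exists>k<length (n # b). P k \<and> block_start (n # b) k \<le> r
        \<and> r < block_start (n # b) k + (n # b) ! k) \<longleftrightarrow>
      P 0 \<and> r < n \<or> r \<ge> n \<and> (\<exists>k<length b. Q k \<and> block_start b k \<le> r - n
        \<and> r - n < block_start b k + b ! k)"
    (is "?L \<longleftrightarrow> ?R") for r
  proof -
    have start: "block_start (n # b) 0 = 0" "block_start (n # b) (Suc k) = n + block_start b k" for k
      by (simp_all add: block_start_def)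
    have "?L \<longleftrightarrow> P 0 \<and> r < n \<or>
        (\<exists>k<length b. Q k \<and> n + block_start b k \<le> r \<and> r < n + block_start b k + b ! k)"
      unfolding list.size add_Suc_right add_0_right Ex_less_Suc2 start Q_def nth_Cons_0 nth_Cons_Suc
      by simp
    also have "\<dots> \<longleftrightarrow> ?R"
    proof -
      have "n + s \<le> r \<and> r < n + s + t \<longleftrightarrow> n \<le> r \<and> s \<le> r - n \<and> r - n < s + t" for s t
        by linarith
      then show ?thesis by blast
    qed
    finally show ?thesis .
  qed
  show ?case
  proof (intro conjI allI impI)
    show "D P (n # b) \<in> carrier_mat (sum_list (n # b)) (sum_list (n # b))"
      unfolding D using Cons.IH[of Q] A by auto
  next
    fix r c assume rc: "r < sum_list (n # b)" "c < sum_list (n # b)"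
    let ?E = "\<exists>k<length b. Q k \<and> block_start b k \<le> r - n \<and> r - n < block_start b k + b ! k"
    have DQ: "dim_row (D Q b) = sum_list b" "dim_col (D Q b) = sum_list b"
      using Cons.IH[of Q] by auto
    have v: "\<not> r < n \<Longrightarrow> \<not> c < n \<Longrightarrow>
        D Q b $$ (r - n, c - n) = (if r - n = c - n \<and> ?E then 1 else 0)"
      using Cons.IH[of Q] rc by simp
    have dA: "dim_row ?A = n" "dim_col ?A = n" by simp_all
    have "D P (n # b) $$ (r, c) = (if r < n
        then if c < n then ?A $$ (r, c) else 0\<^sub>m n (sum_list b) $$ (r, c - n)
        else if c < n then 0\<^sub>m (sum_list b) n $$ (r - n, c) else D Q b $$ (r - n, c - n))"
      unfolding D using rc DQ dA by (subst index_mat_four_block(1)) simp_all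
    also have "\<dots> = (if r = c \<and> (P 0 \<and> r < n \<or> r \<ge> n \<and> ?E) then 1 else 0)"
    proof (cases "r < n"; cases "c < n")
      assume "\<not> r < n" "\<not> c < n"
      moreover from this have "r - n = c - n \<longleftrightarrow> r = c" by linarith
      ultimately show ?thesis using v by simp
    qed (use rc in auto)
    finally show "D P (n # b) $$ (r, c) = (if r = c \<and> (\<exists>k<length (n # b). P k \<and>
        block_start (n # b) k \<le> r \<and> r < block_start (n # b) k + (n # b) ! k) then 1 else 0)"
      unfolding ex .
  qed
qed

lemma block_start_le: "i < length b \<Longrightarrow> block_start b i + b ! i \<le> sum_list b"
proof -
  assume "i < length b"
  then have "sum_list b = sum_list (take i b) + (b ! i + sum_list (drop (Suc i) b))"
    by (metis Cons_nth_drop_Suc append_take_drop_id sum_list.Cons sum_list_append)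
  then show ?thesis by (simp add: block_start_def)
qed

lemma block_proj_carrier [simp]: "block_proj b i \<in> carrier_mat (sum_list b) (sum_list b)"
  using diag_block_indicator_index[of "\<lambda>k. k = i" b] by (simp add: block_proj_def)

lemma block_proj_index:
  assumes "i < length b" "r < sum_list b" "c < sum_list b"
  shows "block_proj b i $$ (r, c) =
    (if r = c \<and> block_start b i \<le> r \<and> r < block_start b i + b ! i then 1 else 0)"
  using diag_block_indicator_index[of "\<lambda>k. k = i" b] assms by (auto simp: block_proj_def)

lemma trace_block_proj_outer:
  assumes "x \<in> carrier_vec (sum_list b)" "i < length b"
  shows "mat_trace (block_proj b i * outer x) = vec_block b x i \<bullet> vec_block b x i"
proof -
  let ?N = "sum_list b" and ?s = "block_start b i"
  have B: "block_proj b i \<in> carrier_mat ?N ?N" and X: "outer x \<in> carrier_mat ?N ?N"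
    using assms(1) outer_carrier[of x] by auto
  have "mat_trace (block_proj b i * outer x) =
      (\<Sum>r<?N. \<Sum>c<?N. block_proj b i $$ (r, c) * outer x $$ (c, r))"
  proof -
    have d: "dim_row (block_proj b i) = ?N" "dim_col (block_proj b i) = ?N"
        "dim_row (outer x) = ?N" "dim_col (outer x) = ?N"
      using B X by blast+
    show ?thesis
      unfolding mat_trace_def index_mult_mat(2) d
      by (intro sum.cong refl) (simp add: d scalar_prod_def atLeast0LessThan del: outer_index)
  qed
  also have "\<dots> = (\<Sum>r<?N. \<Sum>c<?N. if c = r then
      (if ?s \<le> r \<and> r < ?s + b ! i then x $ r * x $ r else 0) else 0)"
    using assms by (intro sum.cong refl) (auto simp: block_proj_index)
  also have "\<dots> = (\<Sum>r<?N. if r \<in> {?s..<?s + b ! i} then x $ r * x $ r else 0)"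
    by (intro sum.cong refl) simp
  also have "\<dots> = (\<Sum>r\<in>{?s..<?s + b ! i}. x $ r * x $ r)"
    using block_start_le[OF assms(2)]
    by (subst sum.inter_restrict[symmetric]) (auto intro!: sum.cong)
  also have "\<dots> = (\<Sum>r<b ! i. x $ (?s + r) * x $ (?s + r))"
    by (rule sum.reindex_bij_witness[of _ "\<lambda>r. ?s + r" "\<lambda>r. r - ?s"]) auto
  finally show ?thesis
    by (simp add: vec_block_def scalar_prod_def atLeast0LessThan)
qed

end

(* Randomised rounding. Factor X = V V^T, draw a standard Gaussian vector g and put xi = V g and
   y = A xi. The vector x with x_i = sqrt (X_ii) * sgn y_i has the same diagonal of x x^T as X, so
   it satisfies every block constraint, and x^T A xi = sum_i sqrt (X_ii) * |y_i|. Expanding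
   0 <= (x - s xi)^T A (x - s xi) bounds 2 s x^T A xi by phi + s^2 xi^T A xi. Taking expectations,
   with E |<a, g>| = sqrt (2 / pi) * |a|, E xi^T A xi = trace (A X), Cauchy-Schwarz and
   s = sqrt (2 / pi), gives 2 s^2 psi <= phi + s^2 psi. The upper bound holds because
   x x^T is feasible for the semidefinite program. *)
theory Submission
  imports "HOL-Probability.Distributions" Defs
begin

hide_type (open) Finite_Cartesian_Product.vec
hide_const (open) Finite_Cartesian_Product.vec
no_notation Finite_Cartesian_Product.vec_nth (infixl "$" 90)
no_notation inner (infix "\<bullet>" 70)

section \<open>Moments of linear forms in independent standard Gaussians\<close>

abbreviation std_gaussian :: "'i set \<Rightarrow> ('i \<Rightarrow> real) measure" where
  "std_gaussian I \<equiv> PiM I (\<lambda>_. density lborel std_normal_density)"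

text \<open>Stability of the normal law under independent sums. A nonzero coefficient is required
  because \<open>normal_density 0 0\<close> is not a probability density; the moment lemmas below
  treat the zero form separately.\<close>

lemma std_gaussian_distributed_sum:
  fixes a :: "'i \<Rightarrow> real"
  assumes I: "finite I" and nz: "\<exists>i\<in>I. a i \<noteq> 0"
  shows "distributed (std_gaussian I) lborel (\<lambda>g. \<Sum>i\<in>I. a i * g i)
    (normal_density 0 (sqrt (\<Sum>i\<in>I. (a i)\<^sup>2)))"
proof -
  let ?N = "density lborel std_normal_density :: real measure"
  interpret N: prob_space ?N
    by (rule prob_space_normal_density) simp
  interpret M: prob_space "std_gaussian I"
    by (rule prob_space_PiM) (rule N.prob_space_axioms)
  have coord: "distributed (std_gaussian I) lborel (\<lambda>g. g i) std_normal_density" if "i \<in> I" for i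
  proof -
    have "distr (std_gaussian I) lborel (\<lambda>g. g i) = distr (std_gaussian I) ?N (\<lambda>g. g i)"
      by (rule distr_cong) auto
    also have "\<dots> = ?N"
      using that by (intro distr_PiM_component N.prob_space_axioms)
    finally show ?thesis
      using that by (auto simp: distributed_def)
  qed
  \<comment> \<open>Independence is read off the joint law: on the product space the tuple of all
    coordinates is the identity map, so its law is the product of the marginals.\<close>
  have "distr (std_gaussian I) (std_gaussian I) (\<lambda>g. restrict g I) =
      distr (std_gaussian I) (std_gaussian I) (\<lambda>g. g)"
    by (rule distr_cong) (auto simp: space_PiM)
  also have "\<dots> = (\<Pi>\<^sub>M i\<in>I. distr (std_gaussian I) ?N (\<lambda>g. g i))"
    unfolding distr_id2[OF refl]
    by (intro PiM_cong refl distr_PiM_component[symmetric] N.prob_space_axioms)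
  finally have "M.indep_vars (\<lambda>_. ?N) (\<lambda>i g. g i) I"
    using nz by (subst M.indep_vars_iff_distr_eq_PiM') auto
  then have indep: "M.indep_vars (\<lambda>_. borel) (\<lambda>i g. a i * g i) I"
    by (rule M.indep_vars_compose2) auto
  \<comment> \<open>The rule for sums of independent normals wants positive standard deviations, so
    the terms with coefficient zero are dropped first.\<close>
  define J where "J = {i\<in>I. a i \<noteq> 0}"
  have "M.indep_vars (\<lambda>_. borel) (\<lambda>i g. a i * g i) J"
    using indep by (rule M.indep_vars_subset) (auto simp: J_def)
  moreover have "distributed (std_gaussian I) lborel (\<lambda>g. a i * g i) (normal_density 0 \<bar>a i\<bar>)"
    if "i \<in> J" for i
    using M.normal_density_affine[OF coord, of i "a i" 0] that by (simp add: J_def)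
  ultimately have "distributed (std_gaussian I) lborel (\<lambda>g. \<Sum>i\<in>J. a i * g i)
      (normal_density (\<Sum>i\<in>J. 0) (sqrt (\<Sum>i\<in>J. \<bar>a i\<bar>\<^sup>2)))"
    using I nz by (intro M.sum_indep_normal) (auto simp: J_def)
  moreover have "(\<Sum>i\<in>J. f i) = (\<Sum>i\<in>I. f i)" if "\<And>i. a i = 0 \<Longrightarrow> f i = 0" for f :: "'i \<Rightarrow> real"
    using I that by (intro sum.mono_neutral_left) (auto simp: J_def)
  ultimately show ?thesis by simp
qed

text \<open>The form is a standard normal variable Z scaled by the Euclidean norm of
  \<open>a\<close>, and E |Z| = sqrt (2 / pi). This is where the constant of the theorem comes
  from.\<close>

lemma std_gaussian_abs_moment:
  fixes a :: "'i \<Rightarrow> real"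
  assumes I: "finite I"
  shows "has_bochner_integral (std_gaussian I) (\<lambda>g. \<bar>\<Sum>i\<in>I. a i * g i\<bar>)
    (sqrt (2 / pi) * sqrt (\<Sum>i\<in>I. (a i)\<^sup>2))"
proof (cases "\<exists>i\<in>I. a i \<noteq> 0")
  case True
  let ?s = "sqrt (\<Sum>i\<in>I. (a i)\<^sup>2)"
  have s: "0 < ?s"
    using True I by (auto intro!: sum_pos2)
  note D = std_gaussian_distributed_sum[OF I True]
  show ?thesis
    using normal_moment_abs_odd[OF s, of 0 0]
      distributed_integral[OF D, of abs] distributed_integrable[OF D, of abs]
    by (simp add: has_bochner_integral_iff mult.commute)
next
  case False
  then show ?thesis by (simp add: has_bochner_integral_zero)
qed

lemma std_gaussian_second_moment:
  fixes a :: "'i \<Rightarrow> real"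
  assumes I: "finite I"
  shows "has_bochner_integral (std_gaussian I) (\<lambda>g. (\<Sum>i\<in>I. a i * g i)\<^sup>2) (\<Sum>i\<in>I. (a i)\<^sup>2)"
proof (cases "\<exists>i\<in>I. a i \<noteq> 0")
  case True
  let ?s = "sqrt (\<Sum>i\<in>I. (a i)\<^sup>2)"
  have s: "0 < ?s"
    using True I by (auto intro!: sum_pos2)
  note D = std_gaussian_distributed_sum[OF I True]
  show ?thesis
    using normal_moment_even[OF s, of 0 1]
      distributed_integral[OF D, of "\<lambda>x. x\<^sup>2"] distributed_integrable[OF D, of "\<lambda>x. x\<^sup>2"] s
    by (simp add: has_bochner_integral_iff sum_nonneg)
next
  case False
  then show ?thesis by (simp add: has_bochner_integral_zero)
qed

text \<open>Polarisation: g_c g_d is a quarter of the difference of the squares of g_c + g_d and g_c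
  - g_d, two linear forms with known second moments. The computation also covers c = d.\<close>

lemma std_gaussian_covariance:
  assumes I: "finite I" and c: "c \<in> I" and d: "d \<in> I"
  shows "has_bochner_integral (std_gaussian I) (\<lambda>g. g c * g d) (of_bool (c = d))"
proof -
  let ?e = "\<lambda>t i. of_bool (i = c) + t * of_bool (i = d) :: real"
  have lin: "(\<Sum>i\<in>I. ?e t i * g i) = g c + t * g d" for t and g :: "'a \<Rightarrow> real"
    using I c d by (simp add: distrib_right sum.distrib mult.assoc flip: sum_distrib_left)
  have sq: "(\<Sum>i\<in>I. (?e t i)\<^sup>2) = 1 + t\<^sup>2 + 2 * t * of_bool (c = d)" for t
  proof -
    have "(?e t i)\<^sup>2 = of_bool (i = c) * 1 + t\<^sup>2 * of_bool (i = d) + 2 * t * of_bool (c = d) * of_bool (i = c)" for i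
      by (auto simp: power2_eq_square algebra_simps)
    then show ?thesis
      using I c d by (simp add: sum.distrib flip: sum_distrib_left)
  qed
  have "has_bochner_integral (std_gaussian I)
      (\<lambda>g. ((g c + 1 * g d)\<^sup>2 - (g c + (-1) * g d)\<^sup>2) / 4)
      (((1 + 1\<^sup>2 + 2 * 1 * of_bool (c = d)) - (1 + (-1)\<^sup>2 + 2 * (-1) * of_bool (c = d))) / 4)"
    unfolding lin[symmetric] sq[symmetric]
    by (intro has_bochner_integral_divide_zero has_bochner_integral_diff std_gaussian_second_moment I)
  moreover have "((g c + 1 * g d)\<^sup>2 - (g c + (-1) * g d)\<^sup>2) / 4 = g c * g d" for g :: "'a \<Rightarrow> real"
    by (simp add: power2_eq_square algebra_simps)
  ultimately show ?thesis by simp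
qed

section \<open>Gram factorisation of positive semidefinite kernels\<close>

text \<open>Cholesky factorisation by induction on the index set, one Schur complement per element.
  Kernels on a finite set are used instead of matrices so that removing an index needs no
  renumbering.\<close>

lemma psd_kernel_factor:
  fixes K :: "'a \<Rightarrow> 'a \<Rightarrow> real"
  assumes "finite S"
    and "\<And>i j. i \<in> S \<Longrightarrow> j \<in> S \<Longrightarrow> K i j = K j i"
    and "\<And>w. 0 \<le> (\<Sum>i\<in>S. \<Sum>j\<in>S. w i * K i j * w j)"
  shows "\<exists>v. \<forall>i\<in>S. \<forall>j\<in>S. K i j = (\<Sum>c\<in>S. v c i * v c j)"
  using assms
proof (induction S arbitrary: K rule: finite_induct)
  case empty
  then show ?case by simp
next
  case (insert s S)
  note sym = insert.prems(1) and psd = insert.prems(2)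
  define L where "L w = (\<Sum>j\<in>S. K s j * w j)" for w
  define Q where "Q w = (\<Sum>i\<in>S. \<Sum>j\<in>S. w i * K i j * w j)" for w
  have form: "0 \<le> t\<^sup>2 * K s s + 2 * t * L w + Q w" for t w
  proof -
    let ?w = "w(s := t)"
    have s: "i \<noteq> s" if "i \<in> S" for i
      using that insert.hyps by auto
    have "(\<Sum>i\<in>insert s S. \<Sum>j\<in>insert s S. ?w i * K i j * ?w j) =
        t\<^sup>2 * K s s + (\<Sum>j\<in>S. t * K s j * w j) + (\<Sum>i\<in>S. w i * K i s * t) + Q w"
      using insert.hyps by (simp add: sum.distrib power2_eq_square s Q_def cong: sum.cong_simp)
    also have "(\<Sum>i\<in>S. w i * K i s * t) = (\<Sum>j\<in>S. t * K s j * w j)"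
      by (intro sum.cong) (simp_all add: sym)
    also have "\<dots> = t * L w"
      by (simp add: L_def sum_distrib_left mult.assoc)
    finally show ?thesis using psd[of ?w] by simp
  qed
  have zero: "K s j = 0" if "K s s = 0" "j \<in> S" for j
  proof (rule ccontr)
    assume "K s j \<noteq> 0"
    define d where "d i = (of_bool (i = j) :: real)" for i
    have pick: "(\<Sum>k\<in>S. f k * d k) = f j" for f
      using that insert.hyps by (simp add: d_def)
    have "Q d = (\<Sum>i\<in>S. (\<Sum>k\<in>S. K i k * d k) * d i)"
      by (simp add: Q_def sum_distrib_left mult_ac)
    then have "L d = K s j" "Q d = K j j"
      by (simp_all add: L_def pick)
    \<comment> \<open>This \<open>t\<close> cancels \<open>K j j\<close> and leaves the value -1,
      since the quadratic term in \<open>t\<close> vanishes with \<open>K s s\<close>.\<close>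
    then show False
      using form[of "- (K j j + 1) / (2 * K s j)" d] \<open>K s s = 0\<close> \<open>K s j \<noteq> 0\<close>
      by (simp add: field_simps)
  qed
  \<comment> \<open>Schur complement; if \<open>K s s = 0\<close> the quotient is \<open>0\<close>, and row \<open>s\<close> of \<open>K\<close> vanishes.\<close>
  define K' where "K' i j = K i j - K s i * K s j / K s s" for i j
  have "\<exists>v. \<forall>i\<in>S. \<forall>j\<in>S. K' i j = (\<Sum>c\<in>S. v c i * v c j)"
  proof (rule insert.IH)
    fix w
    have "(\<Sum>i\<in>S. \<Sum>j\<in>S. w i * K' i j * w j) = Q w - (\<Sum>i\<in>S. \<Sum>j\<in>S. (K s i * w i) * (K s j * w j) / K s s)"
      by (simp add: K'_def Q_def algebra_simps sum_subtractf)
    also have "(\<Sum>i\<in>S. \<Sum>j\<in>S. (K s i * w i) * (K s j * w j) / K s s) = (L w)\<^sup>2 / K s s"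
      by (simp add: L_def power2_eq_square sum_product sum_divide_distrib)
    \<comment> \<open>For \<open>K s s > 0\<close> the chosen \<open>t\<close> minimises the form,
      and the minimum is the Schur complement form. For \<open>K s s = 0\<close> division by zero
      makes \<open>t\<close> zero, and both sides reduce to \<open>Q w\<close>.\<close>
    finally show "0 \<le> (\<Sum>i\<in>S. \<Sum>j\<in>S. w i * K' i j * w j)"
      using form[of "- L w / K s s" w] by (cases "K s s = 0") (simp_all add: power2_eq_square)
  qed (simp add: K'_def sym)
  then obtain v where v: "K' i j = (\<Sum>c\<in>S. v c i * v c j)" if "i \<in> S" "j \<in> S" for i j
    by blast
  have diag: "0 \<le> K s s"
    using form[of 1 "\<lambda>_. 0"] by (simp add: L_def Q_def)
  \<comment> \<open>The new vector restores the rank-one term subtracted in \<open>K'\<close>; the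
    old vectors are extended by zero at the index \<open>s\<close>.\<close>
  define V where "V c i = (if c = s then K s i / sqrt (K s s) else if i = s then 0 else v c i)" for c i
  have "K i j = (\<Sum>c\<in>insert s S. V c i * V c j)" if ij: "i \<in> insert s S" "j \<in> insert s S" for i j
  proof -
    have "(\<Sum>c\<in>insert s S. V c i * V c j) = K s i * K s j / K s s +
        (if i = s \<or> j = s then 0 else \<Sum>c\<in>S. v c i * v c j)"
    proof -
      have "(\<Sum>c\<in>S. V c i * V c j) = (if i = s \<or> j = s then 0 else \<Sum>c\<in>S. v c i * v c j)"
        using insert.hyps by (auto simp: V_def intro!: sum.cong sum.neutral)
      then show ?thesis
        using insert.hyps diag by (simp add: V_def)
    qed
    also have "\<dots> = K i j"
      using ij v[of i j] sym[of s i] sym[of s j] zero[of i] zero[of j] insert.hyps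
      by (cases "K s s = 0") (auto simp: K'_def)
    finally show ?thesis by simp
  qed
  then show ?case by blast
qed

section \<open>Gaussian sign rounding\<close>

text \<open>The block constraints enter only through \<open>bound\<close>: they depend on the
  diagonal of x x^T alone, so every vector whose squared entries are the diagonal of X is an
  admissible competitor.\<close>

lemma psd_signed_rounding:
  fixes A X :: "'a \<Rightarrow> 'a \<Rightarrow> real"
  assumes S: "finite S"
    and A_sym: "\<And>i j. i \<in> S \<Longrightarrow> j \<in> S \<Longrightarrow> A i j = A j i"
    and A_psd: "\<And>w. 0 \<le> (\<Sum>i\<in>S. \<Sum>j\<in>S. w i * A i j * w j)"
    and X_sym: "\<And>i j. i \<in> S \<Longrightarrow> j \<in> S \<Longrightarrow> X i j = X j i"
    and X_psd: "\<And>w. 0 \<le> (\<Sum>i\<in>S. \<Sum>j\<in>S. w i * X i j * w j)"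
    and bound: "\<And>x. (\<And>i. i \<in> S \<Longrightarrow> (x i)\<^sup>2 = X i i) \<Longrightarrow>
      (\<Sum>i\<in>S. \<Sum>j\<in>S. x i * A i j * x j) \<le> \<phi>"
  shows "2 / pi * (\<Sum>i\<in>S. \<Sum>j\<in>S. A i j * X i j) \<le> \<phi>"
proof -
  obtain v where v: "X i j = (\<Sum>c\<in>S. v c i * v c j)" if "i \<in> S" "j \<in> S" for i j
    using psd_kernel_factor[OF S X_sym X_psd] by blast
  define \<psi> where "\<psi> = (\<Sum>i\<in>S. \<Sum>j\<in>S. A i j * X i j)"
  \<comment> \<open>\<open>w\<close> holds the entries of A V, so that each entry of A \<xi> is
    itself a linear form in \<open>g\<close> and the moment lemmas apply.\<close>
  define w where "w c i = (\<Sum>j\<in>S. A i j * v c j)" for c i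
  define \<xi> where "\<xi> g i = (\<Sum>c\<in>S. v c i * g c)" for g i
  define y where "y g i = (\<Sum>c\<in>S. w c i * g c)" for g i
  \<comment> \<open>With c = sqrt (2 / pi), a general s \<ge> 0 would yield (2 s c - s^2) \<psi>
    \<le> \<phi>. The factor is largest at s = c, where it equals 2 / pi.\<close>
  define s where "s = sqrt (2 / pi)"
  have s: "0 \<le> s" "s\<^sup>2 = 2 / pi" by (simp_all add: s_def)
  have y: "y g i = (\<Sum>j\<in>S. A i j * \<xi> g j)" for g i
    unfolding y_def w_def \<xi>_def sum_distrib_left sum_distrib_right
    by (subst sum.swap) (simp add: mult.assoc)
  have diag: "X i i = (\<Sum>c\<in>S. (v c i)\<^sup>2)" if "i \<in> S" for i
    using v[OF that that] by (simp add: power2_eq_square)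
  have \<psi>: "\<psi> = (\<Sum>i\<in>S. \<Sum>c\<in>S. v c i * w c i)"
  proof -
    have "(\<Sum>j\<in>S. A i j * X i j) = (\<Sum>c\<in>S. v c i * w c i)" if "i \<in> S" for i
    proof -
      have "(\<Sum>j\<in>S. A i j * X i j) = (\<Sum>j\<in>S. \<Sum>c\<in>S. v c i * (A i j * v c j))"
        using that by (intro sum.cong refl) (simp add: v sum_distrib_left mult_ac)
      also have "\<dots> = (\<Sum>c\<in>S. v c i * w c i)"
        by (subst sum.swap) (simp add: w_def sum_distrib_left)
      finally show ?thesis .
    qed
    then show ?thesis by (simp add: \<psi>_def)
  qed
  have pointwise: "2 * s * (\<Sum>i\<in>S. sqrt (X i i) * \<bar>y g i\<bar>) \<le> \<phi> + s\<^sup>2 * (\<Sum>i\<in>S. \<xi> g i * y g i)" for g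
  proof -
    \<comment> \<open>The sign at \<open>y g i = 0\<close> is taken to be 1, not 0, so that the
      square of \<open>x i\<close> is \<open>X i i\<close> there too.\<close>
    define x where "x i = sqrt (X i i) * (if 0 \<le> y g i then 1 else -1)" for i
    have "(x i)\<^sup>2 = X i i" if "i \<in> S" for i
      using diag[OF that] by (simp add: x_def power_mult_distrib sum_nonneg)
    then have x: "(\<Sum>i\<in>S. \<Sum>j\<in>S. x i * A i j * x j) \<le> \<phi>"
      by (rule bound)
    have xy: "x i * y g i = sqrt (X i i) * \<bar>y g i\<bar>" for i
      by (simp add: x_def)
    have form: "(\<Sum>i\<in>S. \<Sum>j\<in>S. u i * A i j * \<xi> g j) = (\<Sum>i\<in>S. u i * y g i)" for u
      by (simp add: y sum_distrib_left mult.assoc)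
    \<comment> \<open>Symmetry of A makes the two cross terms of the expanded square equal.\<close>
    have form': "(\<Sum>i\<in>S. \<Sum>j\<in>S. \<xi> g i * A i j * u j) = (\<Sum>i\<in>S. u i * y g i)" for u
      unfolding form[symmetric] by (subst sum.swap) (auto simp: A_sym mult_ac intro!: sum.cong)
    have "0 \<le> (\<Sum>i\<in>S. \<Sum>j\<in>S. (x i - s * \<xi> g i) * A i j * (x j - s * \<xi> g j))"
      by (rule A_psd)
    also have "\<dots> = (\<Sum>i\<in>S. \<Sum>j\<in>S. x i * A i j * x j) - s * (\<Sum>i\<in>S. \<Sum>j\<in>S. x i * A i j * \<xi> g j)
        - s * (\<Sum>i\<in>S. \<Sum>j\<in>S. \<xi> g i * A i j * x j) + s\<^sup>2 * (\<Sum>i\<in>S. \<Sum>j\<in>S. \<xi> g i * A i j * \<xi> g j)"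
      unfolding sum_distrib_left sum.distrib[symmetric] sum_subtractf[symmetric]
      by (intro sum.cong refl) (simp add: algebra_simps power2_eq_square)
    also have "\<dots> = (\<Sum>i\<in>S. \<Sum>j\<in>S. x i * A i j * x j) - 2 * s * (\<Sum>i\<in>S. sqrt (X i i) * \<bar>y g i\<bar>)
        + s\<^sup>2 * (\<Sum>i\<in>S. \<xi> g i * y g i)"
      unfolding form form' xy by simp
    finally show ?thesis using x by simp
  qed
  let ?G = "std_gaussian S"
  have lhs: "has_bochner_integral ?G (\<lambda>g. 2 * s * (\<Sum>i\<in>S. sqrt (X i i) * \<bar>y g i\<bar>))
      (2 * s * (\<Sum>i\<in>S. sqrt (X i i) * (s * sqrt (\<Sum>c\<in>S. (w c i)\<^sup>2))))"
    unfolding y_def s_def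
    by (intro has_bochner_integral_mult_right has_bochner_integral_sum std_gaussian_abs_moment S)
  \<comment> \<open>The quadratic form is expanded into products \<open>g c * g d\<close>; in
    expectation only the terms with c = d survive, and they add up to \<psi>.\<close>
  have "has_bochner_integral ?G (\<lambda>g. \<Sum>i\<in>S. \<Sum>c\<in>S. \<Sum>d\<in>S. v c i * w d i * (g c * g d))
      (\<Sum>i\<in>S. \<Sum>c\<in>S. \<Sum>d\<in>S. v c i * w d i * of_bool (c = d))"
    by (intro has_bochner_integral_mult_right has_bochner_integral_sum std_gaussian_covariance S)
  moreover have "(\<Sum>c\<in>S. \<Sum>d\<in>S. v c i * w d i * (g c * g d)) = \<xi> g i * y g i" for g i
    by (simp add: \<xi>_def y_def sum_product mult_ac)
  moreover have "(\<Sum>i\<in>S. \<Sum>c\<in>S. \<Sum>d\<in>S. v c i * w d i * of_bool (c = d)) = \<psi>"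
    using S by (simp add: \<psi>)
  ultimately have quad: "has_bochner_integral ?G (\<lambda>g. \<Sum>i\<in>S. \<xi> g i * y g i) \<psi>"
    by simp
  interpret prob_space ?G
    by (intro prob_space_PiM prob_space_normal_density) simp
  have rhs: "has_bochner_integral ?G (\<lambda>g. \<phi> + s\<^sup>2 * (\<Sum>i\<in>S. \<xi> g i * y g i)) (\<phi> + s\<^sup>2 * \<psi>)"
    using quad by (auto simp: has_bochner_integral_iff prob_space)
  \<comment> \<open>Cauchy-Schwarz, where \<open>sqrt (X i i)\<close> is the norm of row i of
    V.\<close>
  have "(\<Sum>c\<in>S. v c i * w c i) \<le> sqrt (X i i) * sqrt (\<Sum>c\<in>S. (w c i)\<^sup>2)" if "i \<in> S" for i
    unfolding diag[OF that] real_sqrt_mult[symmetric]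
    by (rule real_le_rsqrt) (rule Cauchy_Schwarz_ineq_sum)
  then have "2 * s\<^sup>2 * \<psi> \<le> 2 * s\<^sup>2 * (\<Sum>i\<in>S. sqrt (X i i) * sqrt (\<Sum>c\<in>S. (w c i)\<^sup>2))"
    unfolding \<psi> by (intro mult_left_mono sum_mono) simp_all
  also have "\<dots> = 2 * s * (\<Sum>i\<in>S. sqrt (X i i) * (s * sqrt (\<Sum>c\<in>S. (w c i)\<^sup>2)))"
    by (simp add: sum_distrib_left power2_eq_square mult_ac)
  also have "\<dots> \<le> \<phi> + s\<^sup>2 * \<psi>"
    unfolding has_bochner_integral_integral_eq[OF lhs, symmetric]
      has_bochner_integral_integral_eq[OF rhs, symmetric]
    by (intro integral_mono pointwise integrable.intros[OF lhs] integrable.intros[OF rhs])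
  finally show ?thesis
    using s by (simp add: \<psi>_def)
qed

section \<open>Traces and semidefiniteness of matrices as double sums\<close>

lemma mat_trace_mult:
  assumes "A \<in> carrier_mat n m" "X \<in> carrier_mat m n"
  shows "mat_trace (A * X) = (\<Sum>i<n. \<Sum>j<m. A $$ (i, j) * X $$ (j, i))"
  using assms by (auto simp: mat_trace_def scalar_prod_def atLeast0LessThan intro!: sum.cong)

text \<open>\<open>block_proj b i\<close> is a diagonal matrix, so off-diagonal entries of the other
  factor never reach the trace. This carries feasibility from X to the rounded vector.\<close>

lemma trace_block_proj_eqI:
  assumes "X \<in> carrier_mat (sum_list b) (sum_list b)" "Y \<in> carrier_mat (sum_list b) (sum_list b)"
    and "i < length b" "\<And>r. r < sum_list b \<Longrightarrow> X $$ (r, r) = Y $$ (r, r)"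
  shows "mat_trace (block_proj b i * X) = mat_trace (block_proj b i * Y)"
  unfolding mat_trace_mult[OF block_proj_carrier assms(1)] mat_trace_mult[OF block_proj_carrier assms(2)]
  using assms(3,4) by (intro sum.cong refl) (simp add: block_proj_index)

lemma quadratic_form_sum:
  fixes A :: "real mat"
  assumes "A \<in> carrier_mat n n"
  shows "vec n w \<bullet> (A *\<^sub>v vec n w) = (\<Sum>i<n. \<Sum>j<n. w i * A $$ (i, j) * w j)"
  using assms
  by (auto simp: scalar_prod_def atLeast0LessThan sum_distrib_left mult.assoc intro!: sum.cong)

lemma psd_mat_kernel:
  assumes "psd_mat n A"
  shows "i < n \<Longrightarrow> j < n \<Longrightarrow> A $$ (i, j) = A $$ (j, i)"
    and "0 \<le> (\<Sum>i<n. \<Sum>j<n. w i * A $$ (i, j) * w j)"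
proof -
  have A: "A \<in> carrier_mat n n" "transpose_mat A = A"
    using assms by (auto simp: psd_mat_def)
  show "i < n \<Longrightarrow> j < n \<Longrightarrow> A $$ (i, j) = A $$ (j, i)"
    using A index_transpose_mat(1)[of i A j] by auto
  show "0 \<le> (\<Sum>i<n. \<Sum>j<n. w i * A $$ (i, j) * w j)"
    using assms unfolding quadratic_form_sum[OF A(1), symmetric] by (simp add: psd_mat_def)
qed

text \<open>The quadratic form of x x^T at v is the square of the inner product of x and v.\<close>

lemma psd_mat_outer:
  assumes "x \<in> carrier_vec n"
  shows "psd_mat n (outer x)"
proof -
  have x: "dim_vec x = n" using assms by auto
  have X: "outer x \<in> carrier_mat n n"
    using outer_carrier[of x] x by simp
  then have "transpose_mat (outer x) = outer x"
    using x by (intro eq_matI) auto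
  moreover have "v \<bullet> (outer x *\<^sub>v v) = (\<Sum>i<n. x $ i * v $ i)\<^sup>2" if "v \<in> carrier_vec n" for v
  proof -
    have v: "v = vec n (($) v)" using that by auto
    have "v \<bullet> (outer x *\<^sub>v v) = (\<Sum>i<n. \<Sum>j<n. v $ i * outer x $$ (i, j) * v $ j)"
      using outer_carrier[of x] x by (subst (1 2) v, subst quadratic_form_sum) auto
    also have "\<dots> = (\<Sum>i<n. x $ i * v $ i)\<^sup>2"
      using x by (simp add: power2_eq_square sum_product mult_ac)
    finally show ?thesis .
  qed
  ultimately show ?thesis
    using X by (auto simp: psd_mat_def)
qed

lemma trace_mult_outer:
  fixes A :: "real mat"
  assumes "A \<in> carrier_mat n n" "x \<in> carrier_vec n"
  shows "mat_trace (A * outer x) = (\<Sum>i<n. \<Sum>j<n. x $ i * A $$ (i, j) * x $ j)"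
proof -
  have x: "dim_vec x = n" using assms by auto
  then show ?thesis
    using outer_carrier[of x] assms(1)
    by (subst mat_trace_mult[of A n n]) (auto simp: mult_ac intro!: sum.cong)
qed

section \<open>Comparison of the two optimal values\<close>

theorem theorem3p9:
  fixes b :: "nat list" and N :: nat
    and A X_opt :: "real mat" and x_opt :: "real vec" and \<phi> \<psi> :: real
  assumes "sum_list b = N"
    and "psd_mat N A"
    and "\<And>i. i < length b \<Longrightarrow> mat_block b A i i = 1\<^sub>m (b ! i)"
    and "is_arg_max (\<lambda>x. mat_trace (A * outer x)) (qp_feasible b) x_opt"
    and "is_arg_max (\<lambda>X. mat_trace (A * X)) (sdp_feasible b) X_opt"
    and "\<phi> = mat_trace (A * outer x_opt)"
    and "\<psi> = mat_trace (A * X_opt)"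
  shows "2 / pi * \<psi> \<le> \<phi> \<and> \<phi> \<le> \<psi>"
proof -
  let ?N = "sum_list b"
  have A: "psd_mat ?N A" "A \<in> carrier_mat ?N ?N"
    using assms(1,2) by (auto simp: psd_mat_def)
  have X: "sdp_feasible b X_opt" "psd_mat ?N X_opt" "X_opt \<in> carrier_mat ?N ?N"
    and X_max: "\<And>Y. sdp_feasible b Y \<Longrightarrow> mat_trace (A * Y) \<le> \<psi>"
    using assms(5,7) by (auto simp: is_arg_max_def sdp_feasible_def psd_mat_def not_less)
  have x: "qp_feasible b x_opt" "x_opt \<in> carrier_vec ?N"
    and x_max: "\<And>z. qp_feasible b z \<Longrightarrow> mat_trace (A * outer z) \<le> \<phi>"
    using assms(4,6) by (auto simp: is_arg_max_def qp_feasible_def not_less)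
  have "sdp_feasible b (outer x_opt)"
    using x psd_mat_outer[OF x(2)] by (simp add: sdp_feasible_def qp_feasible_def)
  then have "\<phi> \<le> \<psi>"
    unfolding assms(6) by (rule X_max)
  moreover have "2 / pi * (\<Sum>i<?N. \<Sum>j<?N. A $$ (i, j) * X_opt $$ (i, j)) \<le> \<phi>"
  proof (rule psd_signed_rounding)
    fix z assume z: "\<And>i. i \<in> {..<?N} \<Longrightarrow> (z i)\<^sup>2 = X_opt $$ (i, i)"
    let ?z = "vec ?N z"
    have outer: "outer ?z \<in> carrier_mat ?N ?N"
      using outer_carrier[of ?z] by simp
    \<comment> \<open>The rounded vector inherits its feasibility from \<open>X_opt\<close>, whose
      diagonal it reproduces.\<close>
    have "mat_trace (block_proj b i * outer ?z) = mat_trace (block_proj b i * X_opt)"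
      if "i < length b" for i
      using z by (intro trace_block_proj_eqI outer X that) (simp add: power2_eq_square)
    then have "qp_feasible b ?z"
      using X(1) by (simp add: qp_feasible_def sdp_feasible_def)
    then have "mat_trace (A * outer ?z) \<le> \<phi>"
      by (rule x_max)
    then show "(\<Sum>i<?N. \<Sum>j<?N. z i * A $$ (i, j) * z j) \<le> \<phi>"
      using A(2) by (simp add: trace_mult_outer[of A ?N])
  qed (use A X in \<open>auto intro: psd_mat_kernel\<close>)
  \<comment> \<open>The trace pairs the entry (i, j) of A with the entry (j, i) of
    \<open>X_opt\<close>; symmetry of \<open>X_opt\<close> aligns the indices.\<close>
  moreover have "\<psi> = (\<Sum>i<?N. \<Sum>j<?N. A $$ (i, j) * X_opt $$ (i, j))"
    unfolding assms(7) mat_trace_mult[OF A(2) X(3)]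
    by (intro sum.cong refl arg_cong2[of _ _ _ _ "(*)"] psd_mat_kernel(1)[OF X(2)]) auto
  ultimately show ?thesis by simp
qed

end
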